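(* Let $\mathbf{Q}$ be a quantale and $X,Y$ non-empty sets. Then the sup-lattice $\mathbf{Hom}_{\mathbf{Q}}(\mathbf{Q}^X,\mathbf{Q}^Y)$ of all $\mathbf{Q}$-module homomorphisms from $\mathbf{Q}^X$ to $\mathbf{Q}^Y$ (ordered pointwise) and the sup-lattice $\mathbf{Q}^{X\times Y}$ (ordered pointwise) are isomorphic.
   Context: A quantale $\mathbf{Q}=\langle Q,\vee,\cdot,\bot,e\rangle$ is a complete lattice with a monoid structure $\langle Q,\cdot,e\rangle$ whose product distributes over arbitrary joins in both arguments. For a set $X$, $\mathbf{Q}^X$ is the free $\mathbf{Q}$-module on $X$: the set $Q^X$ with pointwise joins and scalar multiplication $(q\star f)(x)=q\cdot f(x)$ (left module notation; analogously for right modules). A $\mathbf{Q}$-module homomorphism is a map preserving arbitrary joins and scalar multiplication. A sup-lattice is a poset with arbitrary joins; sup-lattice isomorphisms are bijections preserving arbitrary joins. *)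

theory Defs
  imports "HOL-Algebra.Group"
begin

record 'a quantale = "'a monoid" +
  qle :: "'a \<Rightarrow> 'a \<Rightarrow> bool"

definition qorder :: "('a, 'r) quantale_scheme \<Rightarrow> 'a gorder"
  where "qorder Q = \<lparr>carrier = carrier Q, eq = (=), le = qle Q\<rparr>"

text \<open>The assumption \<open>B \<subseteq> carrier Q\<close> includes \<open>B = {}\<close>, so the bottom element is absorbing.\<close>

locale quantale = monoid Q + lat: complete_lattice "qorder Q" for Q (structure) +
  assumes mult_Sup_left:
    "\<lbrakk>a \<in> carrier Q; B \<subseteq> carrier Q\<rbrakk>
      \<Longrightarrow> a \<otimes> (\<Squnion>\<^bsub>qorder Q\<^esub> B) = \<Squnion>\<^bsub>qorder Q\<^esub> ((\<lambda>b. a \<otimes> b) ` B)"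
    and mult_Sup_right:
    "\<lbrakk>a \<in> carrier Q; B \<subseteq> carrier Q\<rbrakk>
      \<Longrightarrow> (\<Squnion>\<^bsub>qorder Q\<^esub> B) \<otimes> a = \<Squnion>\<^bsub>qorder Q\<^esub> ((\<lambda>b. b \<otimes> a) ` B)"

text \<open>
  A sup-lattice, i.e. a poset with arbitrary joins, is the same object as a
  \<^locale>\<open>complete_lattice\<close>; only the morphisms differ, and those are given by
  \<^const>\<open>sup_pres\<close>, which also requires both arguments to be complete lattices.
\<close>

lemma (in partial_order) complete_lattice_if_sups:
  assumes sups: "\<And>A. A \<subseteq> carrier L \<Longrightarrow> \<exists>s. least L s (Upper L A)"
  shows "complete_lattice L"
proof (rule complete_latticeI)
  fix A assume A: "A \<subseteq> carrier L"
  then show "\<exists>s. least L s (Upper L A)" by (rule sups)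
  have B: "Lower L A \<subseteq> carrier L" by simp
  from sups[OF B] obtain s where s: "least L s (Upper L (Lower L A))" ..
  then have sc: "s \<in> carrier L" by (rule least_closed)
  have "greatest L s (Lower L A)"
    unfolding greatest_def
  proof (intro conjI ballI)
    show "s \<in> Lower L A"
    proof (rule Lower_memI)
      fix x assume x: "x \<in> A"
      then have "x \<in> Upper L (Lower L A)"
        using A by (auto simp: Upper_def Lower_def)
      then show "s \<sqsubseteq> x" using s by (simp add: least_def)
    qed (rule sc)
    show "x \<sqsubseteq> s" if "x \<in> Lower L A" for x
      using s that Upper_memD[of s L "Lower L A" x] by (simp add: least_def)
  qed (rule B)
  then show "\<exists>i. greatest L i (Lower L A)" ..
qed

definition sup_lattice_isomorphic ::
    "('a, 'c) gorder_scheme \<Rightarrow> ('b, 'd) gorder_scheme \<Rightarrow> bool"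
  where "sup_lattice_isomorphic L M \<longleftrightarrow>
    (\<exists>\<phi>. bij_betw \<phi> (carrier L) (carrier M) \<and> sup_pres L M \<phi>)"

text \<open>Functions on a set \<open>X\<close> are represented by extensional functions, so that equality of
  functions is equality on \<open>X\<close>.\<close>

definition power_poset :: "('a, 'r) gorder_scheme \<Rightarrow> 'x set \<Rightarrow> ('x \<Rightarrow> 'a) gorder"
  where "power_poset L X =
    \<lparr>carrier = X \<rightarrow>\<^sub>E carrier L, eq = (=), le = (\<lambda>f g. \<forall>x\<in>X. f x \<sqsubseteq>\<^bsub>L\<^esub> g x)\<rparr>"

lemma partial_order_power_poset:
  assumes "partial_order L"
  shows "partial_order (power_poset L X)"
proof -
  interpret partial_order L by fact
  have antisym: "f = g"
    if "\<forall>x\<in>X. f x \<sqsubseteq>\<^bsub>L\<^esub> g x" "\<forall>x\<in>X. g x \<sqsubseteq>\<^bsub>L\<^esub> f x" "f \<in> X \<rightarrow>\<^sub>E carrier L" "g \<in> X \<rightarrow>\<^sub>E carrier L" for f g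
  proof (rule PiE_ext[OF that(3,4)])
    show "f x = g x" if "x \<in> X" for x
      using that \<open>\<forall>x\<in>X. f x \<sqsubseteq>\<^bsub>L\<^esub> g x\<close> \<open>\<forall>x\<in>X. g x \<sqsubseteq>\<^bsub>L\<^esub> f x\<close>
        PiE_mem[OF \<open>f \<in> X \<rightarrow>\<^sub>E carrier L\<close> that] PiE_mem[OF \<open>g \<in> X \<rightarrow>\<^sub>E carrier L\<close> that]
      by (intro le_antisym) simp_all
  qed
  have trans: "\<forall>x\<in>X. f x \<sqsubseteq>\<^bsub>L\<^esub> h x"
    if "\<forall>x\<in>X. f x \<sqsubseteq>\<^bsub>L\<^esub> g x" "\<forall>x\<in>X. g x \<sqsubseteq>\<^bsub>L\<^esub> h x"
      "f \<in> X \<rightarrow>\<^sub>E carrier L" "g \<in> X \<rightarrow>\<^sub>E carrier L" "h \<in> X \<rightarrow>\<^sub>E carrier L" for f g h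
  proof
    fix x assume x: "x \<in> X"
    show "f x \<sqsubseteq>\<^bsub>L\<^esub> h x"
      by (rule le_trans[of _ "g x"]) (use that x in \<open>auto simp: PiE_iff\<close>)
  qed
  show ?thesis
  proof
    show "f .=\<^bsub>power_poset L X\<^esub> g"
      if "f \<sqsubseteq>\<^bsub>power_poset L X\<^esub> g" "g \<sqsubseteq>\<^bsub>power_poset L X\<^esub> f"
        "f \<in> carrier (power_poset L X)" "g \<in> carrier (power_poset L X)" for f g
      using that antisym[of f g] by (simp add: power_poset_def)
    show "f \<sqsubseteq>\<^bsub>power_poset L X\<^esub> h"
      if "f \<sqsubseteq>\<^bsub>power_poset L X\<^esub> g" "g \<sqsubseteq>\<^bsub>power_poset L X\<^esub> h"
        "f \<in> carrier (power_poset L X)" "g \<in> carrier (power_poset L X)"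
        "h \<in> carrier (power_poset L X)" for f g h
      using that trans[of f g h] by (simp add: power_poset_def)
  qed (auto simp: power_poset_def PiE_iff)
qed

lemma least_power_poset:
  assumes "complete_lattice L" and F: "F \<subseteq> carrier (power_poset L X)"
  shows "least (power_poset L X) (\<lambda>x\<in>X. \<Squnion>\<^bsub>L\<^esub> ((\<lambda>f. f x) ` F)) (Upper (power_poset L X) F)"
proof -
  interpret complete_lattice L by fact
  let ?s = "\<lambda>x\<in>X. \<Squnion>\<^bsub>L\<^esub> ((\<lambda>f. f x) ` F)"
  have F': "(\<lambda>f. f x) ` F \<subseteq> carrier L" if "x \<in> X" for x
    using F that by (auto simp: power_poset_def)
  have "?s \<in> Upper (power_poset L X) F"
  proof -
    have "f x \<sqsubseteq>\<^bsub>L\<^esub> ?s x" if "f \<in> F" "x \<in> X" for f x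
      using that sup_upper[OF F'[OF \<open>x \<in> X\<close>], of "f x"] by simp
    then show ?thesis
      using F' by (simp add: Upper_def power_poset_def)
  qed
  moreover have "?s \<sqsubseteq>\<^bsub>power_poset L X\<^esub> g" if g: "g \<in> Upper (power_poset L X) F" for g
  proof -
    have "\<Squnion>\<^bsub>L\<^esub> ((\<lambda>f. f x) ` F) \<sqsubseteq>\<^bsub>L\<^esub> g x" if x: "x \<in> X" for x
    proof (rule sup_least)
      show "g x \<in> carrier L" using g x by (auto simp: Upper_def power_poset_def)
      show "y \<sqsubseteq>\<^bsub>L\<^esub> g x" if "y \<in> (\<lambda>f. f x) ` F" for y
        using that g x F by (auto simp: Upper_def power_poset_def)
    qed (rule F'[OF x])
    then show ?thesis by (simp add: power_poset_def)
  qed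
  ultimately show ?thesis
    by (simp add: least_def)
qed

lemma complete_lattice_power_poset:
  assumes "complete_lattice L"
  shows "complete_lattice (power_poset L X)"
proof -
  interpret complete_lattice L by fact
  interpret P: partial_order "power_poset L X"
    by (rule partial_order_power_poset) unfold_locales
  show ?thesis
    by (rule P.complete_lattice_if_sups) (rule exI, rule least_power_poset[OF assms])
qed

lemma sup_power_poset:
  assumes "complete_lattice L" and F: "F \<subseteq> carrier (power_poset L X)"
  shows "\<Squnion>\<^bsub>power_poset L X\<^esub> F = (\<lambda>x\<in>X. \<Squnion>\<^bsub>L\<^esub> ((\<lambda>f. f x) ` F))"
proof -
  interpret P: complete_lattice "power_poset L X"
    using assms(1) by (rule complete_lattice_power_poset)
  show ?thesis
    using P.least_unique[OF P.sup_lub[OF F] least_power_poset[OF assms]] .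
qed

text \<open>
  Modules are left modules. Right modules over \<open>Q\<close> are left modules over the quantale
  obtained from \<open>Q\<close> by reversing the multiplication.
\<close>

record ('q, 'm) qmodule = "'m gorder" +
  scal :: "'q \<Rightarrow> 'm \<Rightarrow> 'm"

definition free_qmodule ::
    "('q, 'r) quantale_scheme \<Rightarrow> 'x set \<Rightarrow> ('q, 'x \<Rightarrow> 'q) qmodule"
  where "free_qmodule Q X =
    \<lparr>carrier = X \<rightarrow>\<^sub>E carrier Q, eq = (=), le = (\<lambda>f g. \<forall>x\<in>X. qle Q (f x) (g x)),
     scal = (\<lambda>q f. \<lambda>x\<in>X. q \<otimes>\<^bsub>Q\<^esub> f x)\<rparr>"

lemma truncate_free_qmodule:
  "gorder.truncate (free_qmodule Q X) = power_poset (qorder Q) X"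
  by (simp add: free_qmodule_def power_poset_def qorder_def gorder.defs)

lemma complete_lattice_truncate:
  "complete_lattice (gorder.truncate M) \<longleftrightarrow> complete_lattice M"
  by (simp add: gorder.defs complete_lattice_def complete_lattice_axioms_def partial_order_def
      partial_order_axioms_def weak_partial_order_def weak_partial_order_axioms_def
      equivalence_def least_def greatest_def Upper_def Lower_def)

lemma complete_lattice_free_qmodule:
  assumes "quantale Q"
  shows "complete_lattice (free_qmodule Q X)"
proof -
  interpret quantale Q by fact
  show ?thesis
    using complete_lattice_power_poset[OF lat.complete_lattice_axioms, of X]
    by (simp flip: complete_lattice_truncate[of "free_qmodule Q X"] add: truncate_free_qmodule)
qed

lemma sup_free_qmodule:
  assumes "quantale Q" and F: "F \<subseteq> carrier (free_qmodule Q X)"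
  shows "\<Squnion>\<^bsub>free_qmodule Q X\<^esub> F = (\<lambda>x\<in>X. \<Squnion>\<^bsub>qorder Q\<^esub> ((\<lambda>f. f x) ` F))"
proof -
  interpret quantale Q by fact
  have "\<Squnion>\<^bsub>free_qmodule Q X\<^esub> F = \<Squnion>\<^bsub>power_poset (qorder Q) X\<^esub> F"
    by (simp add: sup_def least_def Upper_def free_qmodule_def power_poset_def qorder_def)
  also have "\<dots> = (\<lambda>x\<in>X. \<Squnion>\<^bsub>qorder Q\<^esub> ((\<lambda>f. f x) ` F))"
    using F by (intro sup_power_poset lat.complete_lattice_axioms)
      (simp add: free_qmodule_def power_poset_def qorder_def)
  finally show ?thesis .
qed

definition qmodule_hom ::
    "('q, 'r) quantale_scheme \<Rightarrow> ('q, 'm, 's) qmodule_scheme \<Rightarrow> ('q, 'n, 't) qmodule_scheme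
      \<Rightarrow> ('m \<Rightarrow> 'n) set"
  where "qmodule_hom Q M N =
    {h \<in> carrier M \<rightarrow>\<^sub>E carrier N. sup_pres M N h \<and>
      (\<forall>q\<in>carrier Q. \<forall>m\<in>carrier M. h (scal M q m) = scal N q (h m))}"

definition Hom_poset ::
    "('q, 'r) quantale_scheme \<Rightarrow> ('q, 'm, 's) qmodule_scheme \<Rightarrow> ('q, 'n, 't) qmodule_scheme
      \<Rightarrow> ('m \<Rightarrow> 'n) gorder"
  where "Hom_poset Q M N =
    (power_poset N (carrier M)) \<lparr>carrier := qmodule_hom Q M N\<rparr>"

end

theory Submission
  imports Defs
begin

text \<open>
  Every \<open>f\<close> in \<open>Q\<^sup>X\<close> is the join of the scalar multiples \<open>f x \<star> \<delta>\<^sub>x\<close> of the unit vectors, so a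
  homomorphism \<open>h\<close> satisfies \<open>h f y = \<Squnion>x. f x \<cdot> h \<delta>\<^sub>x y\<close> and is determined by its kernel
  \<open>(x, y) \<mapsto> h \<delta>\<^sub>x y\<close>; conversely, every kernel defines a homomorphism by this formula.
  The correspondence is an order isomorphism, and these preserve all existing joins, so it
  is not necessary to compute joins of homomorphisms.
\<close>

section \<open>Order isomorphisms and joins in complete lattices\<close>

text \<open>Only \<open>M\<close> is assumed complete. An element of \<open>L\<close> that \<phi>
  sends to the join of the image of \<open>A\<close> is itself a least upper bound of
  \<open>A\<close>, because \<phi> reflects the order. This yields both completeness of
  \<open>L\<close>, which \<open>sup_pres\<close> demands, and preservation of joins.\<close>

lemma sup_lattice_isomorphic_order_iso:
  assumes "partial_order L" and "complete_lattice M"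
    and surj: "\<phi> ` carrier L = carrier M"
    and le_iff: "\<And>x y. \<lbrakk>x \<in> carrier L; y \<in> carrier L\<rbrakk> \<Longrightarrow> \<phi> x \<sqsubseteq>\<^bsub>M\<^esub> \<phi> y \<longleftrightarrow> x \<sqsubseteq>\<^bsub>L\<^esub> y"
  shows "sup_lattice_isomorphic L M"
proof -
  interpret L: partial_order L by fact
  interpret M: complete_lattice M by fact
  have closed: "\<phi> x \<in> carrier M" if "x \<in> carrier L" for x
    using surj that by blast
  have inj: "inj_on \<phi> (carrier L)"
  proof (rule inj_onI)
    fix x y assume xy: "x \<in> carrier L" "y \<in> carrier L" "\<phi> x = \<phi> y"
    then have "\<phi> x \<sqsubseteq>\<^bsub>M\<^esub> \<phi> y" "\<phi> y \<sqsubseteq>\<^bsub>M\<^esub> \<phi> x" using closed by auto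
    then show "x = y"
      using le_iff[OF xy(1,2)] le_iff[OF xy(2,1)] xy(1,2) by (auto intro: L.le_antisym)
  qed
  have lub: "\<exists>s. least L s (Upper L A) \<and> \<phi> s = \<Squnion>\<^bsub>M\<^esub> (\<phi> ` A)" if A: "A \<subseteq> carrier L" for A
  proof -
    have \<phi>A: "\<phi> ` A \<subseteq> carrier M" using A closed by blast
    then obtain s where s: "s \<in> carrier L" "\<phi> s = \<Squnion>\<^bsub>M\<^esub> (\<phi> ` A)"
      using surj M.sup_closed[OF \<phi>A] by (metis imageE)
    have "x \<sqsubseteq>\<^bsub>L\<^esub> s" if "x \<in> A" for x
      using M.sup_upper[OF \<phi>A, of "\<phi> x"] le_iff[of x s] s A that by auto
    moreover have "s \<sqsubseteq>\<^bsub>L\<^esub> u" if u: "u \<in> Upper L A" for u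
    proof -
      have uc: "u \<in> carrier L" and "\<And>x. x \<in> A \<Longrightarrow> x \<sqsubseteq>\<^bsub>L\<^esub> u"
        using u A by (auto simp: Upper_def)
      then have "\<And>x. x \<in> A \<Longrightarrow> \<phi> x \<sqsubseteq>\<^bsub>M\<^esub> \<phi> u" using le_iff A by blast
      then have "\<phi> s \<sqsubseteq>\<^bsub>M\<^esub> \<phi> u"
        unfolding s(2) by (intro M.sup_least[OF \<phi>A closed[OF uc]]) auto
      then show ?thesis using le_iff s(1) uc by blast
    qed
    ultimately have "least L s (Upper L A)"
      using s(1) by (auto simp: least_def Upper_def)
    with s(2) show ?thesis by blast
  qed
  have cl: "complete_lattice L"
    by (rule L.complete_lattice_if_sups) (use lub in blast)
  interpret L: complete_lattice L by fact
  have "\<phi> (\<Squnion>\<^bsub>L\<^esub> A) = \<Squnion>\<^bsub>M\<^esub> (\<phi> ` A)" if A: "A \<subseteq> carrier L" for A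
    using lub[OF A] L.least_unique[OF L.sup_lub[OF A]] by auto
  then show ?thesis
    unfolding sup_lattice_isomorphic_def sup_pres_def bij_betw_def
    using inj surj cl M.complete_lattice_axioms by blast
qed

lemma (in complete_lattice) sup_mono:
  assumes "\<And>i. i \<in> I \<Longrightarrow> g i \<in> carrier L" "\<And>i. i \<in> I \<Longrightarrow> h i \<in> carrier L"
    and "\<And>i. i \<in> I \<Longrightarrow> g i \<sqsubseteq> h i"
  shows "\<Squnion>(g ` I) \<sqsubseteq> \<Squnion>(h ` I)"
proof (rule sup_least)
  have hI: "h ` I \<subseteq> carrier L" using assms by blast
  show "g ` I \<subseteq> carrier L" using assms by blast
  show "\<Squnion>(h ` I) \<in> carrier L" using hI by simp
  fix x assume "x \<in> g ` I"
  then obtain i where "i \<in> I" "x = g i" by blast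
  then show "x \<sqsubseteq> \<Squnion>(h ` I)"
    using assms hI sup_upper[OF hI, of "h i"] by (auto intro: le_trans[of _ "h i"])
qed

text \<open>Each \<open>g i j\<close> lies below the join over \<open>i\<close> for its
  \<open>j\<close>, hence below the right-hand side. The reverse inequality is the same statement
  with the roles of \<open>I\<close> and \<open>J\<close> exchanged.\<close>

lemma (in complete_lattice) sup_sup_le_commute:
  assumes "\<And>i j. \<lbrakk>i \<in> I; j \<in> J\<rbrakk> \<Longrightarrow> g i j \<in> carrier L"
  shows "\<Squnion>((\<lambda>i. \<Squnion>(g i ` J)) ` I) \<sqsubseteq> \<Squnion>((\<lambda>j. \<Squnion>((\<lambda>i. g i j) ` I)) ` J)"
proof -
  let ?r = "\<Squnion>((\<lambda>j. \<Squnion>((\<lambda>i. g i j) ` I)) ` J)"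
  have row: "g i ` J \<subseteq> carrier L" if "i \<in> I" for i using assms that by blast
  have col: "(\<lambda>i. g i j) ` I \<subseteq> carrier L" if "j \<in> J" for j using assms that by blast
  have cols: "(\<lambda>j. \<Squnion>((\<lambda>i. g i j) ` I)) ` J \<subseteq> carrier L" using col by auto
  then have r: "?r \<in> carrier L" by simp
  have le: "g i j \<sqsubseteq> ?r" if "i \<in> I" "j \<in> J" for i j
  proof (rule le_trans)
    show "g i j \<sqsubseteq> \<Squnion>((\<lambda>i. g i j) ` I)" using that by (intro sup_upper[OF col]) auto
    show "\<Squnion>((\<lambda>i. g i j) ` I) \<sqsubseteq> ?r" using that by (intro sup_upper[OF cols]) auto
  qed (use assms that r col in auto)
  have "\<Squnion>(g i ` J) \<sqsubseteq> ?r" if "i \<in> I" for i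
    using that le by (intro sup_least[OF row[OF that] r]) auto
  then show ?thesis
    using row r by (intro sup_least) auto
qed

lemma (in complete_lattice) sup_sup_commute:
  assumes "\<And>i j. \<lbrakk>i \<in> I; j \<in> J\<rbrakk> \<Longrightarrow> g i j \<in> carrier L"
  shows "\<Squnion>((\<lambda>i. \<Squnion>(g i ` J)) ` I) = \<Squnion>((\<lambda>j. \<Squnion>((\<lambda>i. g i j) ` I)) ` J)"
proof (rule le_antisym)
  show "\<Squnion>((\<lambda>i. \<Squnion>(g i ` J)) ` I) \<sqsubseteq> \<Squnion>((\<lambda>j. \<Squnion>((\<lambda>i. g i j) ` I)) ` J)"
    using assms by (rule sup_sup_le_commute)
  show "\<Squnion>((\<lambda>j. \<Squnion>((\<lambda>i. g i j) ` I)) ` J) \<sqsubseteq> \<Squnion>((\<lambda>i. \<Squnion>(g i ` J)) ` I)"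
    using assms by (rule sup_sup_le_commute[where g = "\<lambda>j i. g i j"])
qed (use assms in \<open>auto intro!: sup_closed\<close>)

text \<open>The empty join is the bottom element, so the entries at \<open>i\<close> different from
  \<open>z\<close> contribute nothing. This evaluates joins in which a unit vector selects one
  index.\<close>

lemma (in complete_lattice) sup_single:
  assumes "z \<in> I" and c: "c \<in> carrier L"
  shows "\<Squnion>((\<lambda>i. if i = z then c else \<Squnion>{}) ` I) = c" (is "\<Squnion>?A = c")
proof (rule le_antisym)
  have A: "?A \<subseteq> carrier L" using c by auto
  have "\<Squnion>{} \<sqsubseteq> c" using c by (intro sup_least) auto
  then show "\<Squnion>?A \<sqsubseteq> c" using c by (intro sup_least[OF A]) auto
  show "c \<sqsubseteq> \<Squnion>?A" using \<open>z \<in> I\<close> by (intro sup_upper[OF A]) (auto intro: rev_image_eqI)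
  show "\<Squnion>?A \<in> carrier L" using A by (rule sup_closed)
qed (rule c)

section \<open>Unit vectors over a quantale\<close>

context quantale
begin

abbreviation qle' (infixl \<open>\<preceq>\<close> 50)
  where "x \<preceq> y \<equiv> qle Q x y"

abbreviation qSup (\<open>\<Or>_\<close> [90] 90)
  where "\<Or>B \<equiv> \<Squnion>\<^bsub>qorder Q\<^esub> B"

lemma carrier_qorder [simp]: "carrier (qorder Q) = carrier Q"
  and le_qorder [simp]: "x \<sqsubseteq>\<^bsub>qorder Q\<^esub> y \<longleftrightarrow> x \<preceq> y"
  by (simp_all add: qorder_def)

lemmas Sup_closed = lat.sup_closed[unfolded carrier_qorder]

text \<open>Distributivity over joins forces monotonicity: \<open>b \<preceq> c\<close> says that
  the join of \<open>b\<close> and \<open>c\<close> is \<open>c\<close>, so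
  \<open>a \<otimes> c\<close> is the join of \<open>a \<otimes> b\<close> and
  \<open>a \<otimes> c\<close>.\<close>

lemma mult_mono_right:
  assumes a: "a \<in> carrier Q" and b: "b \<in> carrier Q" and c: "c \<in> carrier Q" and "b \<preceq> c"
  shows "a \<otimes> b \<preceq> a \<otimes> c"
proof -
  have "\<Or>{b, c} = c"
  proof (rule lat.le_antisym)
    show "\<Or>{b, c} \<sqsubseteq>\<^bsub>qorder Q\<^esub> c"
      using assms lat.le_refl[of c] by (intro lat.sup_least) auto
    show "c \<sqsubseteq>\<^bsub>qorder Q\<^esub> \<Or>{b, c}"
      using assms by (intro lat.sup_upper) auto
  qed (use assms in \<open>auto intro!: Sup_closed\<close>)
  then have "a \<otimes> c = \<Or>{a \<otimes> b, a \<otimes> c}"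
    using mult_Sup_left[OF a, of "{b, c}"] b c by simp
  moreover have "a \<otimes> b \<sqsubseteq>\<^bsub>qorder Q\<^esub> \<Or>{a \<otimes> b, a \<otimes> c}"
    using assms by (intro lat.sup_upper) auto
  ultimately show ?thesis by simp
qed

text \<open>The Kronecker delta, with bottom, written as the empty join, in the role of zero. For
  \<open>x\<close> outside \<open>X\<close> it is constantly bottom, hence still an element of the
  free module.\<close>

definition unit_vec :: "'x set \<Rightarrow> 'x \<Rightarrow> 'x \<Rightarrow> 'a"
  where "unit_vec X x = (\<lambda>z\<in>X. if z = x then \<one> else \<Or>{})"

lemma unit_vec_closed: "unit_vec X x \<in> X \<rightarrow>\<^sub>E carrier Q"
  by (auto simp: unit_vec_def intro: Sup_closed)

text \<open>This is coordinate \<open>z\<close> of the decomposition of \<open>f\<close> into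
  multiples of unit vectors. Terms with \<open>x\<close> different from \<open>z\<close> vanish
  because bottom is absorbing, which is distributivity over the empty join.\<close>

lemma Sup_mult_unit_vec:
  assumes f: "f \<in> X \<rightarrow>\<^sub>E carrier Q" and z: "z \<in> X"
  shows "\<Or>((\<lambda>x. f x \<otimes> unit_vec X x z) ` X) = f z"
proof -
  have "f x \<otimes> unit_vec X x z = (if x = z then f z else \<Or>{})" if "x \<in> X" for x
    using PiE_mem[OF f that] z mult_Sup_left[of "f x" "{}"] by (auto simp: unit_vec_def)
  then have "(\<lambda>x. f x \<otimes> unit_vec X x z) ` X = (\<lambda>x. if x = z then f z else \<Or>{}) ` X"
    by (rule image_cong[OF refl])
  then show ?thesis
    using lat.sup_single[OF z, of "f z"] f z by (auto simp: PiE_mem)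
qed

text \<open>The counterpart with the unit vector as left factor, separate because the product need
  not be commutative.\<close>

lemma Sup_unit_vec_mult:
  assumes k: "k \<in> X \<rightarrow> carrier Q" and x: "x \<in> X"
  shows "\<Or>((\<lambda>z. unit_vec X x z \<otimes> k z) ` X) = k x"
proof -
  have "unit_vec X x z \<otimes> k z = (if z = x then k x else \<Or>{})" if "z \<in> X" for z
    using k that x mult_Sup_right[of "k z" "{}"] by (auto simp: unit_vec_def Pi_iff)
  then have "(\<lambda>z. unit_vec X x z \<otimes> k z) ` X = (\<lambda>z. if z = x then k x else \<Or>{}) ` X"
    by (rule image_cong[OF refl])
  then show ?thesis
    using lat.sup_single[OF x, of "k x"] k x by (auto simp: Pi_iff)
qed

lemma free_qmodule_simps [simp]:
  "carrier (free_qmodule Q X) = X \<rightarrow>\<^sub>E carrier Q"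
  "scal (free_qmodule Q X) q f = (\<lambda>x\<in>X. q \<otimes> f x)"
  "f \<sqsubseteq>\<^bsub>free_qmodule Q X\<^esub> g \<longleftrightarrow> (\<forall>x\<in>X. f x \<preceq> g x)"
  by (simp_all add: free_qmodule_def)

lemmas Sup_free = sup_free_qmodule[OF quantale_axioms, unfolded free_qmodule_simps]

section \<open>The correspondence between homomorphisms and kernels\<close>

lemma qmodule_hom_expand:
  assumes h: "h \<in> qmodule_hom Q (free_qmodule Q X) (free_qmodule Q Y)"
    and f: "f \<in> X \<rightarrow>\<^sub>E carrier Q" and y: "y \<in> Y"
  shows "h f y = \<Or>((\<lambda>x. f x \<otimes> h (unit_vec X x) y) ` X)"
proof -
  let ?M = "free_qmodule Q X" and ?N = "free_qmodule Q Y"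
  let ?g = "\<lambda>x. scal ?M (f x) (unit_vec X x)"
  have fx: "f x \<in> carrier Q" if "x \<in> X" for x using f that by (rule PiE_mem)
  have g: "?g ` X \<subseteq> X \<rightarrow>\<^sub>E carrier Q"
    using fx unit_vec_closed[of X] by (auto simp: PiE_iff)
  \<comment> \<open>The scaled unit vectors join to \<open>f\<close>. Applying \<open>h\<close> then
    uses preservation of joins first and preservation of scalars second.\<close>
  have "\<Squnion>\<^bsub>?M\<^esub> (?g ` X) = (\<lambda>z\<in>X. \<Or>((\<lambda>x. ?g x z) ` X))"
    by (simp only: Sup_free[OF g] image_image)
  also have "\<dots> = (\<lambda>z\<in>X. f z)"
    by (rule restrict_ext) (simp add: Sup_mult_unit_vec[OF f])
  also have "\<dots> = f" using f by (simp add: PiE_restrict)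
  finally have "h f = h (\<Squnion>\<^bsub>?M\<^esub> (?g ` X))" by simp
  also have "\<dots> = \<Squnion>\<^bsub>?N\<^esub> (h ` ?g ` X)"
    using h g by (simp add: qmodule_hom_def sup_pres_def)
  also have "h ` ?g ` X = (\<lambda>x. scal ?N (f x) (h (unit_vec X x))) ` X"
    using h fx unit_vec_closed[of X]
    by (auto simp: image_image qmodule_hom_def simp del: free_qmodule_simps(2) intro!: image_cong)
  finally have "h f = \<Squnion>\<^bsub>?N\<^esub> ((\<lambda>x. scal ?N (f x) (h (unit_vec X x))) ` X)" .
  moreover have "(\<lambda>x. scal ?N (f x) (h (unit_vec X x))) ` X \<subseteq> Y \<rightarrow>\<^sub>E carrier Q"
    using h fx unit_vec_closed[of X] by (fastforce simp: qmodule_hom_def PiE_iff)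
  ultimately show ?thesis
    using y by (simp add: Sup_free image_image)
qed

text \<open>The row vector \<open>f\<close> times the matrix \<open>k\<close>, with joins in place
  of sums. The kernel stands on the right because scalars act on the left.\<close>

definition hom_of_kernel :: "'x set \<Rightarrow> 'y set \<Rightarrow> ('x \<times> 'y \<Rightarrow> 'a) \<Rightarrow> ('x \<Rightarrow> 'a) \<Rightarrow> 'y \<Rightarrow> 'a"
  where "hom_of_kernel X Y k =
    (\<lambda>f\<in>X \<rightarrow>\<^sub>E carrier Q. \<lambda>y\<in>Y. \<Or>((\<lambda>x. f x \<otimes> k (x, y)) ` X))"

text \<open>Joins are preserved by distributivity in the left factor and an exchange of two joins,
  scalars by associativity and distributivity in the right factor.\<close>

lemma hom_of_kernel_closed:
  assumes k: "k \<in> X \<times> Y \<rightarrow>\<^sub>E carrier Q"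
  shows "hom_of_kernel X Y k \<in> qmodule_hom Q (free_qmodule Q X) (free_qmodule Q Y)"
proof -
  let ?M = "free_qmodule Q X" and ?N = "free_qmodule Q Y" and ?h = "hom_of_kernel X Y k"
  have kxy: "k (x, y) \<in> carrier Q" if "x \<in> X" "y \<in> Y" for x y
    using k that by (auto intro: PiE_mem)
  have prod: "f x \<otimes> k (x, y) \<in> carrier Q" if "f \<in> X \<rightarrow>\<^sub>E carrier Q" "x \<in> X" "y \<in> Y" for f x y
    using that kxy by (auto simp: PiE_mem)
  have hf: "?h f \<in> Y \<rightarrow>\<^sub>E carrier Q" if "f \<in> X \<rightarrow>\<^sub>E carrier Q" for f
    using prod[OF that] that by (auto simp: hom_of_kernel_def intro!: Sup_closed)
  have sup: "?h (\<Squnion>\<^bsub>?M\<^esub> F) = \<Squnion>\<^bsub>?N\<^esub> (?h ` F)" if F: "F \<subseteq> X \<rightarrow>\<^sub>E carrier Q" for F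
  proof -
    have Fx: "(\<lambda>f. f x) ` F \<subseteq> carrier Q" if "x \<in> X" for x
      using F that by auto
    have SF: "(\<lambda>x\<in>X. \<Or>((\<lambda>f. f x) ` F)) \<in> X \<rightarrow>\<^sub>E carrier Q"
      using Fx by (auto intro!: Sup_closed)
    have "?h (\<Squnion>\<^bsub>?M\<^esub> F) = (\<lambda>y\<in>Y. \<Or>((\<lambda>x. \<Or>((\<lambda>f. f x) ` F) \<otimes> k (x, y)) ` X))"
      using SF by (auto simp: hom_of_kernel_def Sup_free[OF F] cong: image_cong)
    also have "\<dots> = (\<lambda>y\<in>Y. \<Or>((\<lambda>x. \<Or>((\<lambda>f. f x \<otimes> k (x, y)) ` F)) ` X))"
      using Fx kxy by (simp add: mult_Sup_right image_image cong: restrict_cong image_cong)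
    \<comment> \<open>The joins over \<open>X\<close> and over \<open>F\<close> are exchanged, so
      that the inner one becomes the value of the map at a single \<open>f\<close>.\<close>
    also have "\<dots> = (\<lambda>y\<in>Y. \<Or>((\<lambda>f. \<Or>((\<lambda>x. f x \<otimes> k (x, y)) ` X)) ` F))"
      using F prod by (intro restrict_ext lat.sup_sup_commute) auto
    also have "\<dots> = (\<lambda>y\<in>Y. \<Or>((\<lambda>f. ?h f y) ` F))"
      using F by (intro restrict_ext arg_cong[where f = "\<lambda>B. \<Or>B"] image_cong)
        (auto simp: hom_of_kernel_def)
    also have "\<dots> = \<Squnion>\<^bsub>?N\<^esub> (?h ` F)"
    proof -
      have "?h ` F \<subseteq> Y \<rightarrow>\<^sub>E carrier Q" using F hf by blast
      then show ?thesis by (simp add: Sup_free image_image)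
    qed
    finally show ?thesis .
  qed
  have scal: "?h (scal ?M q f) = scal ?N q (?h f)"
    if q: "q \<in> carrier Q" and f: "f \<in> X \<rightarrow>\<^sub>E carrier Q" for q f
  proof -
    have qf: "(\<lambda>x\<in>X. q \<otimes> f x) \<in> X \<rightarrow>\<^sub>E carrier Q" using q f by auto
    have "\<Or>((\<lambda>x. q \<otimes> f x \<otimes> k (x, y)) ` X) = q \<otimes> \<Or>((\<lambda>x. f x \<otimes> k (x, y)) ` X)" if "y \<in> Y" for y
    proof -
      have "(\<lambda>x. q \<otimes> f x \<otimes> k (x, y)) ` X = (\<otimes>) q ` (\<lambda>x. f x \<otimes> k (x, y)) ` X"
        unfolding image_image using q PiE_mem[OF f] kxy that by (intro image_cong) (auto simp: m_assoc)
      then show ?thesis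
        using prod[OF f] that by (subst mult_Sup_left[OF q]) auto
    qed
    then show ?thesis
      using f qf by (auto simp: hom_of_kernel_def cong: image_cong)
  qed
  show ?thesis
  proof -
    have "?h \<in> extensional (X \<rightarrow>\<^sub>E carrier Q)" by (simp add: hom_of_kernel_def)
    then have "?h \<in> (X \<rightarrow>\<^sub>E carrier Q) \<rightarrow>\<^sub>E (Y \<rightarrow>\<^sub>E carrier Q)"
      using hf by (simp add: PiE_def)
    then show ?thesis
      using sup scal complete_lattice_free_qmodule[OF quantale_axioms, of X]
        complete_lattice_free_qmodule[OF quantale_axioms, of Y]
      by (simp add: qmodule_hom_def sup_pres_def del: free_qmodule_simps(2))
  qed
qed

definition kernel_of_hom :: "'x set \<Rightarrow> 'y set \<Rightarrow> (('x \<Rightarrow> 'a) \<Rightarrow> 'y \<Rightarrow> 'a) \<Rightarrow> 'x \<times> 'y \<Rightarrow> 'a"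
  where "kernel_of_hom X Y h = (\<lambda>(x, y)\<in>X \<times> Y. h (unit_vec X x) y)"

lemma kernel_of_hom_closed:
  assumes "h \<in> qmodule_hom Q (free_qmodule Q X) (free_qmodule Q Y)"
  shows "kernel_of_hom X Y h \<in> X \<times> Y \<rightarrow>\<^sub>E carrier Q"
  using assms unit_vec_closed[of X] by (fastforce simp: kernel_of_hom_def qmodule_hom_def)

text \<open>Multiplying a unit vector by \<open>k\<close> selects a row of \<open>k\<close>. This
  provides surjectivity of \<open>kernel_of_hom\<close>.\<close>

lemma kernel_of_hom_of_kernel:
  assumes k: "k \<in> X \<times> Y \<rightarrow>\<^sub>E carrier Q"
  shows "kernel_of_hom X Y (hom_of_kernel X Y k) = k"
proof (rule PiE_ext)
  show "kernel_of_hom X Y (hom_of_kernel X Y k) \<in> X \<times> Y \<rightarrow>\<^sub>E carrier Q"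
    using k by (intro kernel_of_hom_closed hom_of_kernel_closed)
  fix p assume "p \<in> X \<times> Y"
  then obtain x y where p: "p = (x, y)" "x \<in> X" "y \<in> Y" by blast
  have "(\<lambda>x. k (x, y)) \<in> X \<rightarrow> carrier Q"
    using k p by (auto intro: PiE_mem)
  from Sup_unit_vec_mult[OF this \<open>x \<in> X\<close>]
  show "kernel_of_hom X Y (hom_of_kernel X Y k) p = k p"
    using p unit_vec_closed[of X x] by (simp add: kernel_of_hom_def hom_of_kernel_def)
qed (rule k)

text \<open>From kernels to homomorphisms, expand both values over the unit vectors and use
  monotonicity of the product and of joins. Conversely, evaluate at the unit vectors, which are
  themselves elements of the free module.\<close>

lemma kernel_of_hom_le_iff:
  assumes h: "h \<in> qmodule_hom Q (free_qmodule Q X) (free_qmodule Q Y)"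
    and h': "h' \<in> qmodule_hom Q (free_qmodule Q X) (free_qmodule Q Y)"
  shows "(\<forall>p\<in>X \<times> Y. kernel_of_hom X Y h p \<preceq> kernel_of_hom X Y h' p) \<longleftrightarrow>
    (\<forall>f\<in>X \<rightarrow>\<^sub>E carrier Q. \<forall>y\<in>Y. h f y \<preceq> h' f y)"
proof
  assume le: "\<forall>p\<in>X \<times> Y. kernel_of_hom X Y h p \<preceq> kernel_of_hom X Y h' p"
  show "\<forall>f\<in>X \<rightarrow>\<^sub>E carrier Q. \<forall>y\<in>Y. h f y \<preceq> h' f y"
  proof (intro ballI)
    fix f y assume f: "f \<in> X \<rightarrow>\<^sub>E carrier Q" and y: "y \<in> Y"
    have closed: "g (unit_vec X x) y \<in> carrier Q"
      if "g \<in> qmodule_hom Q (free_qmodule Q X) (free_qmodule Q Y)" for g x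
    proof -
      have "g (unit_vec X x) \<in> Y \<rightarrow>\<^sub>E carrier Q"
        using that unit_vec_closed[of X x] by (auto simp: qmodule_hom_def intro: PiE_mem)
      then show ?thesis using y by (rule PiE_mem)
    qed
    have "h (unit_vec X x) y \<preceq> h' (unit_vec X x) y" if "x \<in> X" for x
      using le that y by (auto simp: kernel_of_hom_def)
    then have "\<Or>((\<lambda>x. f x \<otimes> h (unit_vec X x) y) ` X) \<sqsubseteq>\<^bsub>qorder Q\<^esub>
        \<Or>((\<lambda>x. f x \<otimes> h' (unit_vec X x) y) ` X)"
      using f closed[OF h] closed[OF h']
      by (intro lat.sup_mono) (auto intro!: mult_mono_right simp: PiE_mem)
    then show "h f y \<preceq> h' f y"
      using qmodule_hom_expand[OF h f y] qmodule_hom_expand[OF h' f y] by simp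
  qed
qed (auto simp: kernel_of_hom_def unit_vec_closed)

end

section \<open>The poset of homomorphisms and the isomorphism\<close>

text \<open>\<open>Hom_poset\<close> is a power poset cut down to the homomorphisms. A partial order
  restricts to any subset, whereas completeness in general does not.\<close>

lemma partial_order_carrier_subset:
  assumes "partial_order L" and "C \<subseteq> carrier L"
  shows "partial_order (L\<lparr>carrier := C\<rparr>)"
proof -
  interpret partial_order L by fact
  show ?thesis
    using assms(2) by unfold_locales (auto simp: eq_is_equal intro: le_trans)
qed

theorem theorem4p4p14:
  fixes Q :: "('q, 'r) quantale_scheme" and X :: "'x set" and Y :: "'y set"
  assumes "quantale Q" and "X \<noteq> {}" and "Y \<noteq> {}"
  shows "sup_lattice_isomorphic
      (Hom_poset Q (free_qmodule Q X) (free_qmodule Q Y))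
      (power_poset (qorder Q) (X \<times> Y))"
proof -
  interpret quantale Q by fact
  let ?M = "free_qmodule Q X" and ?N = "free_qmodule Q Y"
  interpret N: complete_lattice ?N
    using assms(1) by (rule complete_lattice_free_qmodule)
  show ?thesis
  proof (rule sup_lattice_isomorphic_order_iso[where \<phi> = "kernel_of_hom X Y"])
    show "partial_order (Hom_poset Q ?M ?N)"
      unfolding Hom_poset_def
    proof (rule partial_order_carrier_subset)
      show "partial_order (power_poset ?N (carrier ?M))"
        by (rule partial_order_power_poset) (rule N.partial_order_axioms)
    qed (auto simp: qmodule_hom_def power_poset_def)
    show "complete_lattice (power_poset (qorder Q) (X \<times> Y))"
      by (rule complete_lattice_power_poset) (rule lat.complete_lattice_axioms)
    show "kernel_of_hom X Y ` carrier (Hom_poset Q ?M ?N) =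
        carrier (power_poset (qorder Q) (X \<times> Y))"
    proof
      show "carrier (power_poset (qorder Q) (X \<times> Y)) \<subseteq>
          kernel_of_hom X Y ` carrier (Hom_poset Q ?M ?N)"
      proof
        fix k assume "k \<in> carrier (power_poset (qorder Q) (X \<times> Y))"
        then have k: "k \<in> X \<times> Y \<rightarrow>\<^sub>E carrier Q" by (simp add: power_poset_def)
        \<comment> \<open>The preimage of \<open>k\<close> is
          \<open>hom_of_kernel X Y k\<close>.\<close>
        then show "k \<in> kernel_of_hom X Y ` carrier (Hom_poset Q ?M ?N)"
          using hom_of_kernel_closed[OF k] kernel_of_hom_of_kernel[OF k, symmetric]
          by (simp add: Hom_poset_def)
      qed
    qed (auto simp: Hom_poset_def power_poset_def dest: kernel_of_hom_closed)
  \<comment> \<open>The order on \<open>Hom_poset\<close> unfolds to comparison at every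
    \<open>f\<close> and every \<open>y\<close>, the right-hand side of
    \<open>kernel_of_hom_le_iff\<close>.\<close>
  qed (simp add: Hom_poset_def power_poset_def flip: kernel_of_hom_le_iff)
qed

end
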